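(* For any probability measure $\mu$ on $\mathbb{Z}$ there exists a minimal stopping time $\tau$ with respect to the natural filtration of $(X_n)$ such that $X_\tau\sim\mu$.
   Context: $(X_n)_{n\ge 0}$ is the simple symmetric random walk on $\mathbb{Z}$: $X_0=0$ and $X_n=\sum_{k=1}^n\xi_k$ with $(\xi_k)$ i.i.d., $\mathbb{P}(\xi_k=1)=\mathbb{P}(\xi_k=-1)=\frac12$. All stopping times are with respect to the natural filtration of $(X_n)$ (no external randomisation is allowed) and $X_\tau\sim\mu$ means that $\tau$ is a.s. finite and $X_\tau$ has law $\mu$. A stopping time $\tau$ is called minimal if whenever $\sigma\le\tau$ is a stopping time such that $X_\sigma$ and $X_\tau$ have the same law, then $\sigma=\tau$ a.s. *)

theory Defs
  imports "HOL-Probability.Probability"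
begin

text \<open>The increments are indexed from 1; the value of \<open>\<xi> 0\<close> plays no role.\<close>

locale simple_symmetric_random_walk = prob_space M for M :: "'a measure" +
  fixes \<xi> :: "nat \<Rightarrow> 'a \<Rightarrow> int"
  assumes indep_increments: "indep_vars (\<lambda>_. count_space UNIV) \<xi> {1..}"
    and prob_up: "\<And>k. k \<ge> 1 \<Longrightarrow> prob {\<omega> \<in> space M. \<xi> k \<omega> = 1} = 1 / 2"
    and prob_down: "\<And>k. k \<ge> 1 \<Longrightarrow> prob {\<omega> \<in> space M. \<xi> k \<omega> = -1} = 1 / 2"

definition walk :: "(nat \<Rightarrow> 'a \<Rightarrow> int) \<Rightarrow> nat \<Rightarrow> 'a \<Rightarrow> int" where
  "walk \<xi> n \<omega> = (\<Sum>k=1..n. \<xi> k \<omega>)"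

text \<open>
  Stopping times may take the value \<open>\<infinity>\<close>, so time is \<^typ>\<open>enat\<close> in order to use the library's
  \<^const>\<open>stopping_time\<close>. For finite \<open>t\<close> this is the \<open>\<sigma>\<close>-algebra generated by \<open>X 0, \<dots>, X t\<close>;
  at \<open>t = \<infinity>\<close> it is generated by the whole process, and the stopping time condition
  there is void. No null sets are added.
\<close>

definition natural_filtration :: "'a measure \<Rightarrow> (nat \<Rightarrow> 'a \<Rightarrow> int) \<Rightarrow> enat \<Rightarrow> 'a measure" where
  "natural_filtration M X t = sigma (space M) {X n -` A \<inter> space M | n A. enat n \<le> t}"

lemma filtration_natural_filtration: "filtration (space M) (natural_filtration M X)"
proof
  show "space (natural_filtration M X i) = space M" for i
    unfolding natural_filtration_def by (rule space_measure_of) auto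
next
  fix i j :: enat
  assume "i \<le> j"
  have "sets (natural_filtration M X t) =
      sigma_sets (space M) {X n -` A \<inter> space M | n A. enat n \<le> t}" for t
    unfolding natural_filtration_def by (rule sets_measure_of) auto
  with \<open>i \<le> j\<close> show "sets (natural_filtration M X i) \<le> sets (natural_filtration M X j)"
    by (auto intro!: sigma_sets_mono') (metis order_trans)
qed

text \<open>
  The value 0 on \<open>{\<tau> = \<infinity>}\<close> is a dummy: laws of stopped values are only of interest for
  almost surely finite \<open>\<tau>\<close>.
\<close>

definition stopped_value :: "(nat \<Rightarrow> 'a \<Rightarrow> int) \<Rightarrow> ('a \<Rightarrow> enat) \<Rightarrow> 'a \<Rightarrow> int" where
  "stopped_value X \<tau> \<omega> = (case \<tau> \<omega> of enat n \<Rightarrow> X n \<omega> | \<infinity> \<Rightarrow> 0)"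

definition stopped_law :: "'a measure \<Rightarrow> (nat \<Rightarrow> 'a \<Rightarrow> int) \<Rightarrow> ('a \<Rightarrow> enat) \<Rightarrow> int measure" where
  "stopped_law M X \<tau> = distr M (count_space UNIV) (stopped_value X \<tau>)"

definition embeds :: "'a measure \<Rightarrow> (nat \<Rightarrow> 'a \<Rightarrow> int) \<Rightarrow> ('a \<Rightarrow> enat) \<Rightarrow> int measure \<Rightarrow> bool" where
  "embeds M X \<tau> \<mu> \<longleftrightarrow> (AE \<omega> in M. \<tau> \<omega> < \<infinity>) \<and> stopped_law M X \<tau> = \<mu>"

definition minimal_stopping_time :: "'a measure \<Rightarrow> (nat \<Rightarrow> 'a \<Rightarrow> int) \<Rightarrow> ('a \<Rightarrow> enat) \<Rightarrow> bool" where
  "minimal_stopping_time M X \<tau> \<longleftrightarrow>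
     stopping_time (natural_filtration M X) \<tau> \<and>
     (\<forall>\<sigma>. stopping_time (natural_filtration M X) \<sigma> \<longrightarrow>
          (\<forall>\<omega>\<in>space M. \<sigma> \<omega> \<le> \<tau> \<omega>) \<longrightarrow>
          stopped_law M X \<sigma> = stopped_law M X \<tau> \<longrightarrow>
          (AE \<omega> in M. \<sigma> \<omega> = \<tau> \<omega>))"

end

theory Submission
  imports Defs "HOL-Library.Nat_Bijection"
begin

text \<open>
  Some stopping time embeds \<open>\<mu>\<close>: the first increments, read as binary digits of a uniform variable,
  determine after an almost surely finite time a target with law \<open>\<mu>\<close>, and recurrence brings the
  walk to that target afterwards. Below any embedding there is a minimal one: repeatedly replace
  the current stopping time by a smaller embedding that almost maximises \<open>E 2\<^sup>-\<^sup>\<tau>\<close> among those below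
  it. The sequence is eventually constant at each point, so its infimum \<open>\<tau>\<close> still embeds \<open>\<mu>\<close>, and
  every embedding \<open>\<sigma> \<le> \<tau>\<close> satisfies \<open>E 2\<^sup>-\<^sup>\<sigma> = E 2\<^sup>-\<^sup>\<tau>\<close>, hence \<open>\<sigma> = \<tau>\<close> almost surely.
\<close>

section \<open>Minimal stopping times\<close>

lemma sets_natural_filtration:
  "sets (natural_filtration M X t) =
    sigma_sets (space M) {X n -` A \<inter> space M | n A. enat n \<le> t}"
  unfolding natural_filtration_def by (rule sets_measure_of) auto

lemma space_natural_filtration [simp]: "space (natural_filtration M X t) = space M"
  unfolding natural_filtration_def by (rule space_measure_of) auto

lemma measurable_natural_filtration:
  assumes "enat n \<le> t"
  shows "X n \<in> natural_filtration M X t \<rightarrow>\<^sub>M count_space UNIV"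
proof (rule measurableI)
  fix A
  show "X n -` A \<inter> space (natural_filtration M X t) \<in> sets (natural_filtration M X t)"
    unfolding sets_natural_filtration space_natural_filtration
    by (rule sigma_sets.Basic) (use assms in blast)
qed auto

lemma sets_natural_filtration_subset:
  assumes "\<And>n. X n \<in> M \<rightarrow>\<^sub>M count_space UNIV"
  shows "sets (natural_filtration M X t) \<subseteq> sets M"
  unfolding sets_natural_filtration
  by (rule sets.sigma_sets_subset) (auto intro: measurable_sets[OF assms])

lemma measurable_natural_stopping_time:
  assumes X: "\<And>n. X n \<in> M \<rightarrow>\<^sub>M count_space UNIV"
    and \<tau>: "stopping_time (natural_filtration M X) \<tau>"
  shows "\<tau> \<in> M \<rightarrow>\<^sub>M count_space UNIV"
proof -
  have [measurable]: "\<tau> \<in> M \<rightarrow>\<^sub>M borel"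
    using measurable_stopping_time[OF \<tau> sets_natural_filtration_subset[OF X] ] by simp
  show ?thesis
    by (subst measurable_count_space_eq2_countable)
      (auto intro!: measurable_sets[of \<tau> M borel])
qed

lemma measurable_stopped_value:
  assumes X [measurable]: "\<And>n. X n \<in> M \<rightarrow>\<^sub>M count_space UNIV"
    and \<tau> [measurable]: "\<tau> \<in> M \<rightarrow>\<^sub>M count_space UNIV"
  shows "stopped_value X \<tau> \<in> M \<rightarrow>\<^sub>M count_space UNIV"
proof -
  have "(\<lambda>\<omega>. case \<tau> \<omega> of enat n \<Rightarrow> X n \<omega> | \<infinity> \<Rightarrow> 0) \<in> M \<rightarrow>\<^sub>M count_space UNIV"
  proof (rule measurable_compose_countable[where g = \<tau>
        and f = "\<lambda>t \<omega>. case t of enat n \<Rightarrow> X n \<omega> | \<infinity> \<Rightarrow> 0"])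
    show "(\<lambda>\<omega>. case t of enat n \<Rightarrow> X n \<omega> | \<infinity> \<Rightarrow> 0) \<in> M \<rightarrow>\<^sub>M count_space UNIV" for t
      by (cases t) auto
  qed measurable
  then show ?thesis
    by (simp add: stopped_value_def[abs_def])
qed

section \<open>Infima of sequences of stopping times\<close>

lemma enat_INF_attained:
  fixes a :: "nat \<Rightarrow> enat"
  shows "(INF n. a n) \<in> range a"
  by (metis Inf_enat_def LeastI_ex UNIV_I empty_iff ex_in_conv image_eqI)

text \<open>As \<open>enat\<close> is well-ordered, the infimum is one of the values. Hence it is at
  most \<open>t\<close> exactly when some \<open>\<tau> n \<omega>\<close> is, which is a countable
  union of events known at time \<open>t\<close>.\<close>

lemma stopping_time_INF:
  fixes \<tau> :: "nat \<Rightarrow> 'a \<Rightarrow> enat"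
  assumes "\<And>n. stopping_time F (\<tau> n)"
  shows "stopping_time F (\<lambda>\<omega>. INF n. \<tau> n \<omega>)"
proof
  fix t
  have "(INF n. \<tau> n \<omega>) \<le> t \<longleftrightarrow> (\<exists>n. \<tau> n \<omega> \<le> t)" for \<omega>
  proof
    assume "(INF n. \<tau> n \<omega>) \<le> t"
    with enat_INF_attained[of "\<lambda>n. \<tau> n \<omega>"] show "\<exists>n. \<tau> n \<omega> \<le> t" by auto
  qed (auto intro: INF_lower2)
  moreover have "Measurable.pred (F t) (\<lambda>\<omega>. \<tau> n \<omega> \<le> t)" for n
    using assms by (rule stopping_timeD)
  ultimately show "Measurable.pred (F t) (\<lambda>\<omega>. (INF n. \<tau> n \<omega>) \<le> t)"
    by simp
qed

text \<open>Once a decreasing sequence has reached its minimum, it stays there.\<close>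

lemma decseq_enat_eventually_INF:
  fixes a :: "nat \<Rightarrow> enat"
  assumes "decseq a"
  shows "\<forall>\<^sub>F n in sequentially. a n = (INF n. a n)"
proof -
  obtain N where "(INF n. a n) = a N"
    using enat_INF_attained[of a] by auto
  then have "a n = (INF n. a n)" if "n \<ge> N" for n
    using decseqD[OF assms that] by (metis INF_lower UNIV_I antisym)
  then show ?thesis
    using eventually_at_top_linorder by blast
qed

text \<open>The weight is bounded and strictly decreasing, so its expectation detects any strict
  decrease on a set of positive probability. The expectation of the time itself could be infinite
  and would detect nothing.\<close>

definition enat_weight :: "enat \<Rightarrow> real" where
  "enat_weight t = (case t of enat n \<Rightarrow> (1/2) ^ n | \<infinity> \<Rightarrow> 0)"

lemma enat_weight_bounds: "0 \<le> enat_weight t" "enat_weight t \<le> 1"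
  by (auto simp: enat_weight_def power_le_one split: enat.split)

lemma enat_weight_strict_antimono: "s < t \<Longrightarrow> enat_weight t < enat_weight s"
  by (cases s; cases t) (auto simp: enat_weight_def intro!: power_strict_decreasing)

lemma enat_weight_antimono: "s \<le> t \<Longrightarrow> enat_weight t \<le> enat_weight s"
  using enat_weight_strict_antimono[of s t] by (cases "s = t") (auto simp: less_le)

lemma enat_weight_inject: "enat_weight s = enat_weight t \<longleftrightarrow> s = t"
  by (metis enat_weight_strict_antimono less_irrefl linorder_neqE)

text \<open>At each point the stopped values are eventually constant, because the times are.
  Dominated convergence applied to the indicator of each set \<open>A\<close> then carries the
  common law over to the limit.\<close>

lemma (in prob_space) embeds_INF:
  fixes \<tau> :: "nat \<Rightarrow> 'a \<Rightarrow> enat"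
  assumes X: "\<And>n. X n \<in> M \<rightarrow>\<^sub>M count_space UNIV"
    and stop: "\<And>n. stopping_time (natural_filtration M X) (\<tau> n)"
    and emb: "\<And>n. embeds M X (\<tau> n) \<mu>"
    and dec: "\<And>\<omega>. \<omega> \<in> space M \<Longrightarrow> decseq (\<lambda>n. \<tau> n \<omega>)"
  shows "embeds M X (\<lambda>\<omega>. INF n. \<tau> n \<omega>) \<mu>"
proof -
  define \<tau>' where "\<tau>' = (\<lambda>\<omega>. INF n. \<tau> n \<omega>)"
  have stop': "stopping_time (natural_filtration M X) \<tau>'"
    unfolding \<tau>'_def by (rule stopping_time_INF[OF stop])
  note V [measurable] = measurable_stopped_value[OF X measurable_natural_stopping_time[OF X stop]]
  note V' [measurable] = measurable_stopped_value[OF X measurable_natural_stopping_time[OF X stop']]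
  have \<mu>: "\<mu> = distr M (count_space UNIV) (stopped_value X (\<tau> n))" for n
    using emb by (simp add: embeds_def stopped_law_def)
  interpret \<mu>: prob_space \<mu>
    unfolding \<mu>[of 0] by (rule prob_space_distr) measurable
  have law: "stopped_law M X \<tau>' = \<mu>"
  proof (rule measure_eqI)
    show "sets (stopped_law M X \<tau>') = sets \<mu>"
      by (simp add: stopped_law_def \<mu>[of 0])
    fix A
    have "(\<lambda>n. \<integral>\<omega>. indicator A (stopped_value X (\<tau> n) \<omega>) \<partial>M)
        \<longlonglongrightarrow> (\<integral>\<omega>. indicator A (stopped_value X \<tau>' \<omega>) \<partial>M :: real)"
    proof (rule integral_dominated_convergence[where w = "\<lambda>_. 1"])
      show "AE \<omega> in M. (\<lambda>n. indicator A (stopped_value X (\<tau> n) \<omega>) :: real)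
          \<longlonglongrightarrow> indicator A (stopped_value X \<tau>' \<omega>)"
      proof (rule AE_I2)
        fix \<omega> assume "\<omega> \<in> space M"
        then have "\<forall>\<^sub>F n in sequentially. \<tau> n \<omega> = \<tau>' \<omega>"
          unfolding \<tau>'_def by (intro decseq_enat_eventually_INF dec)
        then have "\<forall>\<^sub>F n in sequentially. indicator A (stopped_value X (\<tau> n) \<omega>)
            = (indicator A (stopped_value X \<tau>' \<omega>) :: real)"
          by eventually_elim (simp add: stopped_value_def)
        then show "(\<lambda>n. indicator A (stopped_value X (\<tau> n) \<omega>) :: real)
          \<longlonglongrightarrow> indicator A (stopped_value X \<tau>' \<omega>)"
          by (rule tendsto_eventually)
      qed
    qed (auto simp: indicator_def)
    moreover have "(\<integral>\<omega>. indicator A (Y \<omega>) \<partial>M) = prob (Y -` A \<inter> space M)" for Y :: "'a \<Rightarrow> int"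
    proof -
      have "(\<integral>\<omega>. indicator A (Y \<omega>) \<partial>M) = (\<integral>\<omega>. indicator (Y -` A) \<omega> \<partial>M :: real)"
        by (simp add: indicator_def of_bool_def)
      then show ?thesis by simp
    qed
    moreover have "prob (stopped_value X (\<tau> n) -` A \<inter> space M) = measure \<mu> A" for n
      by (subst \<mu>[of n], subst measure_distr) auto
    ultimately have "prob (stopped_value X \<tau>' -` A \<inter> space M) = measure \<mu> A"
      by (simp add: LIMSEQ_const_iff)
    then have "measure (stopped_law M X \<tau>') A = measure \<mu> A"
      unfolding stopped_law_def by (subst measure_distr) auto
    moreover have "finite_measure (stopped_law M X \<tau>')"
      unfolding stopped_law_def by (intro finite_measure_distr) measurable
    ultimately show "emeasure (stopped_law M X \<tau>') A = emeasure \<mu> A"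
      by (simp add: finite_measure.emeasure_eq_measure \<mu>.emeasure_eq_measure)
  qed
  have le: "\<tau>' \<omega> \<le> \<tau> 0 \<omega>" for \<omega>
    unfolding \<tau>'_def by (rule INF_lower) simp
  have "AE \<omega> in M. \<tau> 0 \<omega> < \<infinity>"
    using emb by (simp add: embeds_def)
  then have "AE \<omega> in M. \<tau>' \<omega> < \<infinity>"
    by eventually_elim (rule le_less_trans[OF le])
  with law show ?thesis
    by (simp add: embeds_def \<tau>'_def)
qed

lemma (in prob_space) minimal_stopping_time_below:
  assumes X: "\<And>n. X n \<in> M \<rightarrow>\<^sub>M count_space UNIV"
    and stop0: "stopping_time (natural_filtration M X) \<tau>\<^sub>0"
    and emb0: "embeds M X \<tau>\<^sub>0 \<mu>"
  obtains \<tau> where "minimal_stopping_time M X \<tau>" "embeds M X \<tau> \<mu>"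
proof -
  define S where "S = {\<tau>. stopping_time (natural_filtration M X) \<tau> \<and> embeds M X \<tau> \<mu>}"
  define below where "below \<tau> = {\<sigma> \<in> S. \<forall>\<omega>\<in>space M. \<sigma> \<omega> \<le> \<tau> \<omega>}" for \<tau>
  define \<phi> where "\<phi> \<tau> = expectation (\<lambda>\<omega>. enat_weight (\<tau> \<omega>))" for \<tau>
  have int: "integrable M (\<lambda>\<omega>. enat_weight (\<tau> \<omega>))" if "\<tau> \<in> S" for \<tau>
  proof -
    have [measurable]: "\<tau> \<in> M \<rightarrow>\<^sub>M count_space UNIV"
      using that by (intro measurable_natural_stopping_time[OF X]) (auto simp: S_def)
    have [measurable]: "enat_weight \<in> count_space UNIV \<rightarrow>\<^sub>M borel" by simp
    show ?thesis
      by (rule integrable_const_bound[where B = 1]) (auto simp: enat_weight_bounds)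
  qed
  have \<phi>_mono: "\<phi> \<tau> \<le> \<phi> \<sigma>"
    if "\<sigma> \<in> S" "\<tau> \<in> S" "\<And>\<omega>. \<omega> \<in> space M \<Longrightarrow> \<sigma> \<omega> \<le> \<tau> \<omega>" for \<sigma> \<tau>
    unfolding \<phi>_def using that by (intro integral_mono int enat_weight_antimono) auto
  have bdd: "bdd_above (\<phi> ` below \<tau>)" for \<tau>
  proof (rule bdd_aboveI2)
    fix \<sigma> assume "\<sigma> \<in> below \<tau>"
    then show "\<phi> \<sigma> \<le> 1"
      unfolding \<phi>_def by (intro integral_le_const int) (auto simp: below_def enat_weight_bounds)
  qed
  \<comment> \<open>The supremum of \<open>\<phi>\<close> over \<open>below \<tau>\<close> might not
    be attained, so stage \<open>n\<close> accepts a loss of \<open>(1/2) ^ n\<close>, which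
    vanishes in the limit.\<close>
  have "\<exists>\<sigma>. \<sigma> \<in> S \<and> \<sigma> \<in> below \<tau> \<and> (\<forall>\<rho>\<in>below \<tau>. \<phi> \<rho> \<le> \<phi> \<sigma> + (1/2) ^ n)" if "\<tau> \<in> S" for \<tau> n
  proof -
    have "\<phi> ` below \<tau> \<noteq> {}"
      using that by (auto simp: below_def)
    moreover have "(SUP \<rho>\<in>below \<tau>. \<phi> \<rho>) - (1/2) ^ n < (SUP \<rho>\<in>below \<tau>. \<phi> \<rho>)" by simp
    ultimately obtain \<sigma> where "\<sigma> \<in> below \<tau>" "(SUP \<rho>\<in>below \<tau>. \<phi> \<rho>) - (1/2) ^ n < \<phi> \<sigma>"
      using less_cSUP_iff[OF _ bdd] by (metis image_empty)
    moreover have "\<phi> \<rho> \<le> (SUP \<rho>\<in>below \<tau>. \<phi> \<rho>)" if "\<rho> \<in> below \<tau>" for \<rho>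
      by (rule cSUP_upper[OF that bdd])
    ultimately show ?thesis
      by (intro exI[of _ \<sigma>]) (force simp: below_def)
  qed
  then have "\<exists>\<tau>. \<forall>n. \<tau> n \<in> S \<and> \<tau> (Suc n) \<in> below (\<tau> n)
      \<and> (\<forall>\<rho>\<in>below (\<tau> n). \<phi> \<rho> \<le> \<phi> (\<tau> (Suc n)) + (1/2) ^ n)"
    using stop0 emb0
    by (intro dependent_nat_choice[where P = "\<lambda>_ \<tau>. \<tau> \<in> S" and
          Q = "\<lambda>n \<tau> \<sigma>. \<sigma> \<in> below \<tau> \<and> (\<forall>\<rho>\<in>below \<tau>. \<phi> \<rho> \<le> \<phi> \<sigma> + (1/2) ^ n)", simplified])
      (auto simp: S_def)
  then obtain \<tau> where S: "\<And>n. \<tau> n \<in> S" and step: "\<And>n. \<tau> (Suc n) \<in> below (\<tau> n)"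
    and max: "\<And>n \<rho>. \<rho> \<in> below (\<tau> n) \<Longrightarrow> \<phi> \<rho> \<le> \<phi> (\<tau> (Suc n)) + (1/2) ^ n"
    by blast
  define \<tau>' where "\<tau>' = (\<lambda>\<omega>. INF n. \<tau> n \<omega>)"
  have le: "\<tau>' \<omega> \<le> \<tau> n \<omega>" for n \<omega>
    unfolding \<tau>'_def by (rule INF_lower) simp
  have "decseq (\<lambda>n. \<tau> n \<omega>)" if "\<omega> \<in> space M" for \<omega>
    using step that by (auto simp: below_def decseq_Suc_iff)
  then have S': "\<tau>' \<in> S"
    using S unfolding S_def \<tau>'_def by (auto intro!: stopping_time_INF embeds_INF X)
  have "AE \<omega> in M. \<sigma> \<omega> = \<tau>' \<omega>"
    if "stopping_time (natural_filtration M X) \<sigma>" and \<sigma>_le: "\<forall>\<omega>\<in>space M. \<sigma> \<omega> \<le> \<tau>' \<omega>"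
      and "stopped_law M X \<sigma> = stopped_law M X \<tau>'" for \<sigma>
  proof -
    have "AE \<omega> in M. \<tau>' \<omega> < \<infinity>" "stopped_law M X \<tau>' = \<mu>"
      using S' by (auto simp: S_def embeds_def)
    moreover from this(1) AE_space have "AE \<omega> in M. \<sigma> \<omega> < \<infinity>"
      by eventually_elim (use \<sigma>_le le_less_trans in blast)
    ultimately have \<sigma>: "\<sigma> \<in> S"
      using that by (simp add: S_def embeds_def)
    \<comment> \<open>Lying below the infimum, \<open>\<sigma>\<close> is a competitor at every
      stage of the construction.\<close>
    have "\<phi> \<sigma> \<le> \<phi> \<tau>' + (1/2) ^ n" for n
    proof -
      have "\<sigma> \<in> below (\<tau> n)"
        using \<sigma> \<sigma>_le le by (auto simp: below_def intro: order_trans)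
      then have "\<phi> \<sigma> \<le> \<phi> (\<tau> (Suc n)) + (1/2) ^ n" by (rule max)
      also have "\<phi> (\<tau> (Suc n)) \<le> \<phi> \<tau>'"
        by (rule \<phi>_mono[OF S' S le])
      finally show ?thesis by simp
    qed
    moreover have "(\<lambda>n. \<phi> \<tau>' + (1/2) ^ n) \<longlonglongrightarrow> \<phi> \<tau>' + 0"
      by (intro tendsto_intros) auto
    ultimately have "\<phi> \<sigma> \<le> \<phi> \<tau>'"
      by (metis LIMSEQ_le_const add.right_neutral)
    \<comment> \<open>Since \<open>\<sigma> \<le> \<tau>'\<close>, the difference of the weights is
      nonnegative; having mean zero, it vanishes almost surely.\<close>
    with \<phi>_mono[OF \<sigma> S'] \<sigma>_le have "expectation (\<lambda>\<omega>. enat_weight (\<sigma> \<omega>) - enat_weight (\<tau>' \<omega>)) = 0"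
      by (simp add: \<phi>_def int \<sigma> S')
    then have "AE \<omega> in M. enat_weight (\<sigma> \<omega>) - enat_weight (\<tau>' \<omega>) = 0"
      by (subst (asm) integral_nonneg_eq_0_iff_AE)
        (use \<sigma>_le in \<open>auto simp: int \<sigma> S' intro!: enat_weight_antimono\<close>)
    then show ?thesis
      by (simp add: enat_weight_inject)
  qed
  with S' have "minimal_stopping_time M X \<tau>'"
    by (simp add: minimal_stopping_time_def S_def)
  with S' show ?thesis
    by (intro that[of \<tau>']) (auto simp: S_def)
qed

section \<open>Recurrence\<close>

context simple_symmetric_random_walk
begin

section \<open>Joint law of finitely many increments\<close>

lemma measurable_increment: "k \<ge> 1 \<Longrightarrow> \<xi> k \<in> M \<rightarrow>\<^sub>M count_space UNIV"
  using indep_increments by (simp add: indep_vars_def2)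

lemma measurable_walk [measurable]: "walk \<xi> n \<in> M \<rightarrow>\<^sub>M count_space UNIV"
proof -
  have "(\<lambda>\<omega>. \<Sum>k\<in>J. \<xi> k \<omega>) \<in> M \<rightarrow>\<^sub>M count_space UNIV" if "finite J" "J \<subseteq> {1..}" for J
    using that
  proof (induction J rule: finite_induct)
    case (insert k J)
    then have [measurable]: "(\<lambda>\<omega>. \<Sum>k\<in>J. \<xi> k \<omega>) \<in> M \<rightarrow>\<^sub>M count_space UNIV"
      "\<xi> k \<in> M \<rightarrow>\<^sub>M count_space UNIV"
      by (auto intro: measurable_increment)
    show ?case using insert by simp
  qed simp
  then show ?thesis
    unfolding walk_def[abs_def] by auto
qed

lemma walk_add: "walk \<xi> (m + d) \<omega> = walk \<xi> m \<omega> + (\<Sum>k\<in>{m<..m + d}. \<xi> k \<omega>)"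
proof -
  have split: "{1..m + d} = {1..m} \<union> {m<..m + d}" by auto
  show ?thesis
    unfolding walk_def split by (rule sum.union_disjoint) auto
qed

lemma prob_increments_eq:
  assumes "finite J" "J \<subseteq> {1..}" "\<And>k. k \<in> J \<Longrightarrow> e k = 1 \<or> e k = -1"
  shows "prob {\<omega> \<in> space M. \<forall>k\<in>J. \<xi> k \<omega> = e k} = (1 / 2) ^ card J"
proof (cases "J = {}")
  case False
  have "prob {\<omega> \<in> space M. \<forall>k\<in>J. \<xi> k \<omega> = e k} = prob (\<Inter>k\<in>J. \<xi> k -` {e k} \<inter> space M)"
    using False by (intro arg_cong[where f = prob]) auto
  also have "\<dots> = (\<Prod>k\<in>J. prob (\<xi> k -` {e k} \<inter> space M))"
    using assms False by (intro indep_varsD[OF indep_increments]) auto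
  also have "\<dots> = (\<Prod>k\<in>J. 1 / 2)"
  proof (rule prod.cong[OF refl])
    fix k assume "k \<in> J"
    moreover have "\<xi> k -` {e k} \<inter> space M = {\<omega> \<in> space M. \<xi> k \<omega> = e k}" by auto
    ultimately show "prob (\<xi> k -` {e k} \<inter> space M) = 1 / 2"
      using assms(2) assms(3)[of k] prob_up[of k] prob_down[of k] by auto
  qed
  finally show ?thesis by simp
qed (simp add: prob_space)

lemma AE_increments: "AE \<omega> in M. \<forall>k\<ge>1. \<xi> k \<omega> = 1 \<or> \<xi> k \<omega> = -1"
proof -
  have "AE \<omega> in M. \<xi> k \<omega> = 1 \<or> \<xi> k \<omega> = -1" if k: "k \<ge> 1" for k
  proof -
    note [measurable] = measurable_increment[OF k]
    have split: "{\<omega> \<in> space M. \<xi> k \<omega> = 1 \<or> \<xi> k \<omega> = -1}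
        = {\<omega> \<in> space M. \<xi> k \<omega> = 1} \<union> {\<omega> \<in> space M. \<xi> k \<omega> = -1}" by auto
    have "prob {\<omega> \<in> space M. \<xi> k \<omega> = 1 \<or> \<xi> k \<omega> = -1} = 1"
      unfolding split using prob_up[OF k] prob_down[OF k] by (subst finite_measure_Union) auto
    then show ?thesis
      by (subst (asm) prob_Collect_eq_1) auto
  qed
  then show ?thesis
    by (simp add: AE_all_countable)
qed

section \<open>Tail events of the increments\<close>

definition future :: "nat \<Rightarrow> 'a measure" where
  "future m = sigma (space M) (\<Union>k\<in>{m..}. {\<xi> (Suc k) -` A \<inter> space M | A. True})"

lemma sets_future:
  "sets (future m) = sigma_sets (space M) (\<Union>k\<in>{m..}. {\<xi> (Suc k) -` A \<inter> space M | A. True})"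
  unfolding future_def by (rule sets_measure_of) auto

lemma space_future [simp]: "space (future m) = space M"
  unfolding future_def by (rule space_measure_of) auto

lemma sets_future_subset: "sets (future m) \<subseteq> events"
  unfolding sets_future
  by (rule sets.sigma_sets_subset) (auto intro: measurable_sets[OF measurable_increment])

lemma measurable_future: "m < k \<Longrightarrow> \<xi> k \<in> future m \<rightarrow>\<^sub>M count_space UNIV"
proof (rule measurableI)
  fix A
  assume "m < k"
  then obtain l where "k = Suc l" "m \<le> l"
    by (cases k) auto
  then show "\<xi> k -` A \<inter> space (future m) \<in> sets (future m)"
    unfolding sets_future space_future by (intro sigma_sets.Basic) auto
qed auto

text \<open>This is Kolmogorov's 0-1 law. The increments are independent on \<open>{1..}\<close>
  while the 0-1 law is stated for families indexed by all naturals, hence the shift by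
  \<open>Suc\<close>.\<close>

lemma future_0_1_law:
  assumes "\<And>m. E \<in> sets (future m)"
  shows "prob E = 0 \<or> prob E = 1"
proof -
  define G where "G k = sigma_sets (space M) {\<xi> (Suc k) -` A \<inter> space M | A. True}" for k
  show ?thesis
  proof (rule kolmogorov_0_1_law[where A = G])
    show "sigma_algebra (space M) (G i)" for i
      unfolding G_def by (rule sigma_algebra_sigma_sets) auto
    have "indep_sets (\<lambda>k. sigma_sets (space M) {\<xi> k -` A \<inter> space M | A. A \<in> sets (count_space UNIV)}) {1..}"
      using indep_increments by (simp only: indep_vars_def)
    then have *: "indep_sets (\<lambda>k. sigma_sets (space M) {\<xi> k -` A \<inter> space M | A. True}) {1..}"
      by simp
    show "indep_sets G UNIV"
    proof (rule indep_setsI)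
      show "G i \<subseteq> events" for i
        using * unfolding indep_sets_def G_def by auto
      fix A J assume J: "J \<noteq> {}" "finite J" "\<forall>j\<in>J. A j \<in> G j"
      have "prob (\<Inter>j\<in>Suc ` J. A (j - 1)) = (\<Prod>j\<in>Suc ` J. prob (A (j - 1)))"
        using J by (intro indep_setsD[OF *]) (auto simp: G_def)
      then show "prob (\<Inter>j\<in>J. A j) = (\<Prod>j\<in>J. prob (A j))"
        by (simp add: prod.reindex)
    qed
    show "E \<in> tail_events G"
      unfolding tail_events_def
    proof safe
      fix m
      have "sigma_sets (space M) (\<Union>k\<in>{m..}. {\<xi> (Suc k) -` A \<inter> space M | A. True})
          \<subseteq> sigma_sets (space M) (\<Union> (G ` {m..}))"
        by (rule sigma_sets_mono') (auto simp: G_def)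
      with assms[of m] show "E \<in> sigma_sets (space M) (\<Union> (G ` {m..}))"
        by (auto simp: sets_future)
    qed
  qed
qed

text \<open>A run of \<open>L\<close> up steps right after time \<open>N\<close> has probability
  \<open>(1 / 2) ^ L\<close> for every \<open>N\<close>. So the event that such runs occur
  arbitrarily late has at least this positive probability, and by the 0-1 law it has probability
  1.\<close>

lemma AE_up_runs: "AE \<omega> in M. \<forall>L N. \<exists>n\<ge>N. \<forall>k\<in>{n<..n + L}. \<xi> k \<omega> = 1"
proof -
  have "AE \<omega> in M. \<forall>N. \<exists>n\<ge>N. \<forall>k\<in>{n<..n + L}. \<xi> k \<omega> = 1" for L
  proof -
    define B where "B N = {\<omega> \<in> space M. \<exists>n\<ge>N. \<forall>k\<in>{n<..n + L}. \<xi> k \<omega> = 1}" for N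
    have future: "B N \<in> sets (future m)" if "m \<le> N" for m N
    proof -
      have "{\<omega> \<in> space (future m). \<exists>n. N \<le> n \<and> (\<forall>k\<in>{n<..n + L}. \<xi> k \<omega> = 1)} \<in> sets (future m)"
      proof (rule sets.sets_Collect_countable_Ex, cases)
        fix n assume "N \<le> n"
        have [measurable]: "\<xi> k \<in> future m \<rightarrow>\<^sub>M count_space UNIV" if "k \<in> {n<..n + L}" for k
          using that \<open>m \<le> N\<close> \<open>N \<le> n\<close> by (intro measurable_future) auto
        show "{\<omega> \<in> space (future m). N \<le> n \<and> (\<forall>k\<in>{n<..n + L}. \<xi> k \<omega> = 1)} \<in> sets (future m)"
          by measurable
      qed simp
      then show ?thesis unfolding B_def space_future .
    qed
    have [measurable]: "B N \<in> events" for N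
      using future[of 0 N] sets_future_subset by auto
    have dec: "B N' \<subseteq> B N" if "N \<le> N'" for N N'
      unfolding B_def using le_trans[OF that] by blast
    have "(\<lambda>N. prob (B N)) \<longlonglongrightarrow> prob (\<Inter>N. B N)"
      using dec by (intro finite_Lim_measure_decseq) (auto simp only: decseq_def \<open>\<And>N. B N \<in> events\<close>)
    moreover have "(1 / 2) ^ L \<le> prob (B N)" for N
    proof -
      have "(1 / 2) ^ L = prob {\<omega> \<in> space M. \<forall>k\<in>{N<..N + L}. \<xi> k \<omega> = 1}"
        by (subst prob_increments_eq) auto
      also have "\<dots> \<le> prob (B N)"
      proof (rule finite_measure_mono)
        show "{\<omega> \<in> space M. \<forall>k\<in>{N<..N + L}. \<xi> k \<omega> = 1} \<subseteq> B N"
          unfolding B_def using order_refl[of N] by blast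
      qed fact
      finally show ?thesis .
    qed
    ultimately have "(1 / 2) ^ L \<le> prob (\<Inter>N. B N)"
      by (intro LIMSEQ_le_const) auto
    moreover have "prob (\<Inter>N. B N) = 0 \<or> prob (\<Inter>N. B N) = 1"
    proof (rule future_0_1_law)
      fix m
      have "(\<Inter>N. B N) = (\<Inter>N. B (max m N))"
        using dec[OF max.cobounded2[of _ m]] by blast
      also have "\<dots> \<in> sets (future m)"
        by (intro sets.countable_INT) (auto intro: future)
      finally show "(\<Inter>N. B N) \<in> sets (future m)" .
    qed
    ultimately have "prob (\<Inter>N. B N) = 1"
      using zero_less_power[of "1/2 :: real" L] by linarith
    then have "AE \<omega> in M. \<omega> \<in> (\<Inter>N. B N)"
      by (subst (asm) prob_eq_1) auto
    then show ?thesis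
      by eventually_elim (auto simp: B_def)
  qed
  then show ?thesis
    by (simp add: AE_all_countable)
qed

text \<open>For \<open>c = 1\<close> the walk has limit superior plus infinity, for
  \<open>c = -1\<close> limit inferior minus infinity. The factor \<open>c\<close> lets one argument
  serve both signs.\<close>

definition unbounded_event :: "int \<Rightarrow> 'a set" where
  "unbounded_event c = {\<omega> \<in> space M. \<forall>K N. \<exists>n\<ge>N. K \<le> c * walk \<xi> n \<omega>}"

text \<open>Removing the first \<open>m\<close> increments shifts the walk by the constant
  \<open>walk \<xi> m \<omega>\<close>. As the threshold \<open>K\<close> is arbitrary, it absorbs
  this shift.\<close>

lemma unbounded_event_in_future: "unbounded_event c \<in> sets (future m)"
proof -
  let ?S = "\<lambda>d \<omega>. \<Sum>k\<in>{m<..m + d}. \<xi> k \<omega>"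
  have "unbounded_event c = {\<omega> \<in> space (future m). \<forall>K N. \<exists>d. N \<le> d \<and> K \<le> c * ?S d \<omega>}"
  proof -
    have "(\<forall>K N. \<exists>n\<ge>N. K \<le> c * walk \<xi> n \<omega>) \<longleftrightarrow> (\<forall>K N. \<exists>d. N \<le> d \<and> K \<le> c * ?S d \<omega>)" for \<omega>
    proof safe
      fix K N
      assume "\<forall>K N. \<exists>n\<ge>N. K \<le> c * walk \<xi> n \<omega>"
      then obtain n where "N + m \<le> n" "K + c * walk \<xi> m \<omega> \<le> c * walk \<xi> n \<omega>" by blast
      then show "\<exists>d. N \<le> d \<and> K \<le> c * ?S d \<omega>"
        using walk_add[of m "n - m" \<omega>] by (intro exI[of _ "n - m"]) (auto simp: algebra_simps)
    next
      fix K N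
      assume "\<forall>K N. \<exists>d. N \<le> d \<and> K \<le> c * ?S d \<omega>"
      then obtain d where "N \<le> d" "K - c * walk \<xi> m \<omega> \<le> c * ?S d \<omega>" by blast
      then show "\<exists>n\<ge>N. K \<le> c * walk \<xi> n \<omega>"
        using walk_add[of m d \<omega>] by (intro exI[of _ "m + d"]) (auto simp: algebra_simps)
    qed
    then show ?thesis by (simp add: unbounded_event_def)
  qed
  also have "\<dots> \<in> sets (future m)"
  proof -
    have [measurable]: "?S d \<in> future m \<rightarrow>\<^sub>M count_space UNIV" for d
    proof (induction d)
      case (Suc d)
      have "{m<..m + Suc d} = insert (m + Suc d) {m<..m + d}" by auto
      then have "?S (Suc d) = (\<lambda>\<omega>. \<xi> (m + Suc d) \<omega> + ?S d \<omega>)" by auto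
      moreover note Suc [measurable] measurable_future[of m "m + Suc d", measurable]
      ultimately show ?case by simp
    qed simp
    have [measurable]: "Measurable.pred (future m) (\<lambda>\<omega>. K \<le> c * ?S d \<omega>)" for K d
      by (rule measurable_compose[where g = "\<lambda>x. K \<le> c * x" and f = "?S d" and N = "count_space UNIV"])
        simp_all
    show ?thesis by measurable
  qed
  finally show ?thesis .
qed

lemma unbounded_event_0_1: "prob (unbounded_event c) = 0 \<or> prob (unbounded_event c) = 1"
  by (rule future_0_1_law) (rule unbounded_event_in_future)

text \<open>Symmetry: by independence the joint law is the product of the marginals, and each
  increment has the same law as its negative. So both sequences give the same probability to any
  event on sequence space.\<close>

lemma prob_unbounded_event_uminus: "prob (unbounded_event (-1)) = prob (unbounded_event 1)"
proof -
  let ?C = "\<lambda>_. count_space UNIV :: int measure"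
  let ?P = "Pi\<^sub>M {1::nat..} ?C"
  let ?f = "\<lambda>c \<omega>. \<lambda>k\<in>{1..}. c * \<xi> k \<omega>"
  have meas: "?f c \<in> M \<rightarrow>\<^sub>M ?P" for c
    using measurable_increment by (intro measurable_restrict) auto
  have law: "distr M ?P (?f c) = (\<Pi>\<^sub>M k\<in>{1..}. distr M (count_space UNIV) (\<lambda>\<omega>. c * \<xi> k \<omega>))" for c
  proof (subst indep_vars_iff_distr_eq_PiM'[symmetric])
    show "indep_vars ?C (\<lambda>k \<omega>. c * \<xi> k \<omega>) {1..}"
      by (rule indep_vars_compose2[OF indep_increments]) simp
  qed (use measurable_increment in auto)
  \<comment> \<open>It suffices to compare atoms. At 1 and -1 both have mass 1/2, and elsewhere both
    are null.\<close>
  have "distr M (count_space UNIV) (\<lambda>\<omega>. -1 * \<xi> k \<omega>) = distr M (count_space UNIV) (\<lambda>\<omega>. 1 * \<xi> k \<omega>)"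
    if k: "k \<ge> 1" for k
  proof (rule measure_eqI_countable)
    note [measurable] = measurable_increment[OF k]
    fix a :: int
    have neg: "(\<lambda>\<omega>. -1 * \<xi> k \<omega>) -` {a} \<inter> space M = {\<omega> \<in> space M. \<xi> k \<omega> = -a}"
      and pos: "(\<lambda>\<omega>. 1 * \<xi> k \<omega>) -` {a} \<inter> space M = {\<omega> \<in> space M. \<xi> k \<omega> = a}"
      by auto
    have "prob {\<omega> \<in> space M. \<xi> k \<omega> = -a} = prob {\<omega> \<in> space M. \<xi> k \<omega> = a}"
    proof (cases "a = 1 \<or> a = -1")
      case False
      have "AE \<omega> in M. \<xi> k \<omega> = 1 \<or> \<xi> k \<omega> = -1"
        using AE_increments by eventually_elim (use k in auto)
      then have "AE \<omega> in M. \<xi> k \<omega> \<noteq> -a" "AE \<omega> in M. \<xi> k \<omega> \<noteq> a"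
        by (eventually_elim, use False in auto)+
      then show ?thesis
        by (subst (asm) (1 2) prob_Collect_eq_0[symmetric]) auto
    qed (use prob_up[OF k] prob_down[OF k] in auto)
    then show "emeasure (distr M (count_space UNIV) (\<lambda>\<omega>. -1 * \<xi> k \<omega>)) {a}
        = emeasure (distr M (count_space UNIV) (\<lambda>\<omega>. 1 * \<xi> k \<omega>)) {a}"
      by (subst (1 2) emeasure_distr) (auto simp only: neg pos emeasure_eq_measure, measurable)
  qed auto
  then have same_law: "distr M ?P (?f (-1)) = distr M ?P (?f 1)"
    unfolding law by (intro PiM_cong) auto
  \<comment> \<open>Unboundedness above, as an event on the space of step sequences. Its preimages
    under \<open>?f 1\<close> and \<open>?f (-1)\<close> are the two events to be compared.\<close>
  define A where "A = {f \<in> space ?P. \<forall>K N. \<exists>n\<ge>N. K \<le> (\<Sum>k=1..n. f k)}"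
  have partial_sum: "(\<lambda>f. \<Sum>k=1..n. f k) \<in> ?P \<rightarrow>\<^sub>M count_space UNIV" for n
  proof (induction n)
    case (Suc n)
    have comp: "(\<lambda>f. f (Suc n)) \<in> ?P \<rightarrow>\<^sub>M count_space UNIV"
      by (rule measurable_component_singleton) simp
    have "(\<lambda>f. i + f (Suc n)) \<in> ?P \<rightarrow>\<^sub>M count_space UNIV" for i
      by (rule measurable_compose[OF comp]) simp
    from measurable_compose_countable[OF this Suc]
    have "(\<lambda>f. (\<Sum>k=1..n. f k) + f (Suc n)) \<in> ?P \<rightarrow>\<^sub>M count_space UNIV" .
    then show ?case by simp
  qed simp
  have A [measurable]: "A \<in> sets ?P"
  proof -
    have [measurable]: "Measurable.pred ?P (\<lambda>f. K \<le> (\<Sum>k=1..n. f k))" for K n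
      by (rule measurable_compose[OF partial_sum]) simp
    show ?thesis
      unfolding A_def by measurable
  qed
  have preimage: "unbounded_event c = ?f c -` A \<inter> space M" for c
  proof -
    have "(\<Sum>k=1..n. ?f c \<omega> k) = c * walk \<xi> n \<omega>" for n \<omega>
      by (simp add: walk_def sum_distrib_left)
    then show ?thesis
      by (auto simp: unbounded_event_def A_def space_PiM simp del: restrict_apply)
  qed
  have "prob (unbounded_event c) = measure (distr M ?P (?f c)) A" for c
    unfolding preimage by (rule measure_distr[OF meas A, symmetric])
  then show ?thesis
    by (simp only: same_law)
qed

text \<open>If one event were null, by symmetry both would be. The walk would then eventually stay
  in a bounded strip, which a long enough run of up steps leaves. So neither is null, and the 0-1
  law applies.\<close>

lemma AE_oscillates: "AE \<omega> in M. \<omega> \<in> unbounded_event 1 \<and> \<omega> \<in> unbounded_event (-1)"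
proof -
  have [measurable]: "unbounded_event c \<in> events" for c
    using unbounded_event_in_future[of c 0] sets_future_subset by auto
  have "prob (unbounded_event 1) \<noteq> 0"
  proof
    assume "prob (unbounded_event 1) = 0"
    moreover from this have "prob (unbounded_event (-1)) = 0"
      by (simp add: prob_unbounded_event_uminus)
    ultimately have "AE \<omega> in M. \<omega> \<notin> unbounded_event 1" "AE \<omega> in M. \<omega> \<notin> unbounded_event (-1)"
      by (simp_all add: prob_eq_0)
    with AE_space AE_up_runs have "AE \<omega> in M. False"
    proof eventually_elim
      case (elim \<omega>)
      have bound: "\<exists>K N. \<forall>n\<ge>N. c * walk \<xi> n \<omega> < K" if "\<omega> \<notin> unbounded_event c" for c
        using that elim(1) by (simp add: unbounded_event_def) (metis not_less)
      obtain K N where K: "walk \<xi> n \<omega> < K" if "N \<le> n" for n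
        using bound[OF elim(3)] by auto
      obtain K' N' where K': "- walk \<xi> n \<omega> < K'" if "N' \<le> n" for n
        using bound[OF elim(4)] by auto
      \<comment> \<open>At late times the walk is above \<open>-K'\<close> and below
        \<open>K\<close>, so a run of at least \<open>K + K'\<close> up steps must cross the
        strip.\<close>
      define L where "L = nat (K + K')"
      obtain n where n: "max N N' \<le> n" and run: "\<forall>k\<in>{n<..n + L}. \<xi> k \<omega> = 1"
        using elim by blast
      have "walk \<xi> (n + L) \<omega> = walk \<xi> n \<omega> + L"
        using run by (simp add: walk_add)
      with K[of "n + L"] K'[of n] n show False
        unfolding L_def by linarith
    qed
    then show False by simp
  qed
  with unbounded_event_0_1[of 1] have "prob (unbounded_event 1) = 1" by simp
  moreover from this have "prob (unbounded_event (-1)) = 1"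
    by (simp add: prob_unbounded_event_uminus)
  ultimately have "AE \<omega> in M. \<omega> \<in> unbounded_event 1" "AE \<omega> in M. \<omega> \<in> unbounded_event (-1)"
    by (simp_all add: prob_eq_1)
  then show ?thesis by eventually_elim simp
qed

text \<open>After time \<open>N\<close> the walk is at some time at most \<open>y\<close> and later
  at least \<open>y\<close>. With steps of size 1 it cannot jump over \<open>y\<close> in
  between.\<close>

lemma AE_recurrent: "AE \<omega> in M. \<forall>y N. \<exists>n\<ge>N. walk \<xi> n \<omega> = y"
  using AE_oscillates AE_increments
proof eventually_elim
  case (elim \<omega>)
  show ?case
  proof (intro allI)
    fix y N
    have "\<exists>m\<ge>N. - y \<le> -1 * walk \<xi> m \<omega>"
      using elim unfolding unbounded_event_def by blast
    then obtain m where m: "N \<le> m" "walk \<xi> m \<omega> \<le> y" by auto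
    have "\<exists>n\<ge>Suc m. y \<le> 1 * walk \<xi> n \<omega>"
      using elim unfolding unbounded_event_def by blast
    then obtain n where n: "Suc m \<le> n" "y \<le> walk \<xi> n \<omega>" by auto
    have step: "\<xi> (Suc i) \<omega> = 1 \<or> \<xi> (Suc i) \<omega> = -1" for i
      using elim by simp
    have "\<bar>walk \<xi> (i + 1) \<omega> - walk \<xi> i \<omega>\<bar> \<le> 1" for i
      using step[of i] by (auto simp: walk_def)
    then obtain i where "m \<le> i" "walk \<xi> i \<omega> = y"
      using nat_intermed_int_val[of m n "\<lambda>i. walk \<xi> i \<omega>" y] m n by auto
    then show "\<exists>n\<ge>N. walk \<xi> n \<omega> = y"
      using m by (intro exI[of _ i]) auto
  qed
qed

end

section \<open>Binary codes of paths\<close>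

text \<open>The first \<open>n\<close> steps are read as a binary number with \<open>f 1\<close> as
  the leading digit; an up step is the digit 1 and every other value the digit 0.\<close>

fun path_code :: "(nat \<Rightarrow> int) \<Rightarrow> nat \<Rightarrow> nat" where
  "path_code f 0 = 0"
| "path_code f (Suc n) = 2 * path_code f n + of_bool (f (Suc n) = 1)"

text \<open>With \<open>code_upper\<close>, these are the endpoints of the dyadic interval of length
  \<open>1 / 2 ^ n\<close> that contains the number with these binary digits. The infinite expansion
  is never formed, so every decision rests on finitely many steps.\<close>

definition code_lower :: "(nat \<Rightarrow> int) \<Rightarrow> nat \<Rightarrow> real" where
  "code_lower f n = path_code f n / 2 ^ n"

definition code_upper :: "(nat \<Rightarrow> int) \<Rightarrow> nat \<Rightarrow> real" where
  "code_upper f n = (path_code f n + 1) / 2 ^ n"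

lemma path_code_less: "path_code f n < 2 ^ n"
  by (induction n) auto

text \<open>The parity of the code gives back the last digit, and halving gives back the code before
  it.\<close>

lemma path_code_eqD:
  "path_code f n = path_code g n \<Longrightarrow> k \<in> {1..n} \<Longrightarrow> f k = 1 \<longleftrightarrow> g k = 1"
proof (induction n)
  case (Suc n)
  have "path_code f n = path_code g n \<and> (f (Suc n) = 1 \<longleftrightarrow> g (Suc n) = 1)"
    using Suc.prems(1) by (cases "f (Suc n) = 1"; cases "g (Suc n) = 1"; simp; presburger)
  with Suc show ?case by (cases "k = Suc n") auto
qed simp

lemma code_lower_nonneg: "0 \<le> code_lower f n"
  by (simp add: code_lower_def)

lemma code_lower_less_upper: "code_lower f n < code_upper f n"
  by (simp add: code_lower_def code_upper_def divide_strict_right_mono)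

lemma code_lower_less_1: "code_lower f n < 1"
  using path_code_less[of f n] by (simp add: code_lower_def)

text \<open>A further digit selects the left or the right half of the interval, so the intervals are
  nested.\<close>

lemma code_lower_mono: "m \<le> n \<Longrightarrow> code_lower f m \<le> code_lower f n"
  by (rule lift_Suc_mono_le[of "code_lower f"]) (auto simp: code_lower_def field_simps)

lemma code_upper_antimono: "m \<le> n \<Longrightarrow> code_upper f n \<le> code_upper f m"
  by (rule lift_Suc_antimono_le[of "code_upper f"]) (auto simp: code_upper_def field_simps)

text \<open>Scaled by \<open>2 ^ n\<close>, this counts the dyadic intervals of level
  \<open>n\<close> inside a given interval: they correspond to the integers from the ceiling of
  \<open>a\<close> up to, but excluding, the floor of \<open>b\<close>.\<close>

lemma card_unit_cells_between:
  fixes a b :: real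
  assumes "0 \<le> a" "a \<le> b"
  shows "finite {v::nat. a \<le> real v \<and> real v + 1 \<le> b}" (is "finite ?A")
    and "card {v::nat. a \<le> real v \<and> real v + 1 \<le> b} \<le> b - a"
proof -
  have sub: "?A \<subseteq> {nat \<lceil>a\<rceil>..<nat \<lfloor>b\<rfloor>}"
  proof safe
    fix v :: nat
    assume "a \<le> real v" "real v + 1 \<le> b"
    then have "\<lceil>a\<rceil> \<le> int v" "int v + 1 \<le> \<lfloor>b\<rfloor>"
      by (simp_all add: ceiling_le_iff le_floor_iff)
    then have "nat \<lceil>a\<rceil> \<le> v" "v < nat \<lfloor>b\<rfloor>" by linarith+
    then show "v \<in> {nat \<lceil>a\<rceil>..<nat \<lfloor>b\<rfloor>}" by (simp only: atLeastLessThan_iff)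
  qed
  then show "finite ?A" by (rule finite_subset) simp
  have "card ?A \<le> nat \<lfloor>b\<rfloor> - nat \<lceil>a\<rceil>"
    using card_mono[OF _ sub] by simp
  moreover have "real (nat \<lfloor>b\<rfloor> - nat \<lceil>a\<rceil>) \<le> b - a"
  proof (cases "nat \<lceil>a\<rceil> \<le> nat \<lfloor>b\<rfloor>")
    case True
    have "real (nat \<lfloor>b\<rfloor>) \<le> b" "a \<le> real (nat \<lceil>a\<rceil>)"
      using assms by linarith+
    with True show ?thesis by (simp add: of_nat_diff)
  next
    case False
    then have "nat \<lfloor>b\<rfloor> - nat \<lceil>a\<rceil> = 0" by linarith
    with assms show ?thesis by simp
  qed
  ultimately show "card ?A \<le> b - a" by linarith
qed

text \<open>Closed unit cells overlap only at integers, so a point lies in at most two of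
  them.\<close>

lemma card_unit_cells_at:
  fixes a :: real
  shows "finite {v::nat. real v \<le> a \<and> a \<le> real v + 1}" (is "finite ?A")
    and "card {v::nat. real v \<le> a \<and> a \<le> real v + 1} \<le> 2"
proof -
  have sub: "?A \<subseteq> {nat \<lfloor>a\<rfloor> - 1, nat \<lfloor>a\<rfloor>}"
  proof
    fix v :: nat
    assume "v \<in> ?A"
    then have "int v \<le> \<lfloor>a\<rfloor>" "\<lfloor>a\<rfloor> \<le> int v + 1" by (auto, linarith+)
    then show "v \<in> {nat \<lfloor>a\<rfloor> - 1, nat \<lfloor>a\<rfloor>}" by auto
  qed
  then show "finite ?A" by (rule finite_subset) simp
  have "card ?A \<le> card {nat \<lfloor>a\<rfloor> - 1, nat \<lfloor>a\<rfloor>}"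
    by (rule card_mono[OF _ sub]) simp
  also have "\<dots> \<le> 2"
    using card_length[of "[nat \<lfloor>a\<rfloor> - 1, nat \<lfloor>a\<rfloor>]"] by simp
  finally show "card ?A \<le> 2" .
qed

lemma measurable_path_code:
  assumes "\<And>k. k \<in> {1..n} \<Longrightarrow> X k \<in> N \<rightarrow>\<^sub>M count_space UNIV"
  shows "(\<lambda>\<omega>. path_code (\<lambda>k. X k \<omega>) n) \<in> N \<rightarrow>\<^sub>M count_space UNIV"
  using assms
proof (induction n)
  case (Suc n)
  have X: "X (Suc n) \<in> N \<rightarrow>\<^sub>M count_space UNIV"
    using Suc.prems by simp
  have step: "(\<lambda>\<omega>. 2 * c + of_bool (X (Suc n) \<omega> = 1)) \<in> N \<rightarrow>\<^sub>M count_space UNIV" for c :: nat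
    by (rule measurable_compose[OF X]) simp
  have IH: "(\<lambda>\<omega>. path_code (\<lambda>k. X k \<omega>) n) \<in> N \<rightarrow>\<^sub>M count_space UNIV"
    using Suc by simp
  from measurable_compose_countable[OF step IH] show ?case by simp
qed simp

lemma measurable_code_bounds:
  assumes "\<And>k. k \<in> {1..n} \<Longrightarrow> X k \<in> N \<rightarrow>\<^sub>M count_space UNIV"
  shows "(\<lambda>\<omega>. code_lower (\<lambda>k. X k \<omega>) n) \<in> borel_measurable N"
    and "(\<lambda>\<omega>. code_upper (\<lambda>k. X k \<omega>) n) \<in> borel_measurable N"
  unfolding code_lower_def code_upper_def
  by (rule measurable_compose[OF measurable_path_code[OF assms]]; simp)+

text \<open>Countable additivity extends the inequality from atoms to all sets. Applied to a set and
  to its complement, it becomes an equality because both total masses are 1.\<close>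

lemma prob_space_eqI_le:
  fixes \<mu> \<nu> :: "'b::countable measure"
  assumes "prob_space \<mu>" "prob_space \<nu>"
    and [measurable_cong]: "sets \<mu> = sets (count_space UNIV)" "sets \<nu> = sets (count_space UNIV)"
    and le: "\<And>z. measure \<nu> {z} \<le> measure \<mu> {z}"
  shows "\<nu> = \<mu>"
proof -
  interpret \<mu>: prob_space \<mu> by fact
  interpret \<nu>: prob_space \<nu> by fact
  have space: "space \<mu> = UNIV" "space \<nu> = UNIV"
    using assms(3,4)[THEN sets_eq_imp_space_eq] by simp_all
  have le': "measure \<nu> A \<le> measure \<mu> A" for A
  proof -
    have "emeasure \<nu> A = (\<integral>\<^sup>+z. emeasure \<nu> {z} \<partial>count_space A)"
      by (rule emeasure_countable_singleton) (auto simp: assms(4))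
    also have "\<dots> \<le> (\<integral>\<^sup>+z. emeasure \<mu> {z} \<partial>count_space A)"
      by (intro nn_integral_mono) (simp add: \<mu>.emeasure_eq_measure \<nu>.emeasure_eq_measure le)
    also have "\<dots> = emeasure \<mu> A"
      by (rule emeasure_countable_singleton[symmetric]) (auto simp: assms(3))
    finally show ?thesis
      by (simp add: \<mu>.emeasure_eq_measure \<nu>.emeasure_eq_measure)
  qed
  show ?thesis
  proof (rule measure_eqI)
    fix A
    have "measure \<nu> (UNIV - A) = 1 - measure \<nu> A" "measure \<mu> (UNIV - A) = 1 - measure \<mu> A"
      using \<nu>.prob_compl[of A] \<mu>.prob_compl[of A] by (simp_all add: space assms(3,4))
    with le'[of A] le'[of "UNIV - A"] show "emeasure \<nu> A = emeasure \<mu> A"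
      by (simp add: \<mu>.emeasure_eq_measure \<nu>.emeasure_eq_measure)
  qed (simp add: assms(3,4))
qed

text \<open>The first time is at most a finite \<open>N\<close> exactly when one of
  \<open>P 0\<close> to \<open>P N\<close> holds, and each of these is known at time
  \<open>N\<close>.\<close>

lemma stopping_time_first:
  fixes F :: "enat \<Rightarrow> 'a measure"
  assumes "\<And>n t. enat n \<le> t \<Longrightarrow> Measurable.pred (F t) (P n)"
  shows "stopping_time F (\<lambda>\<omega>. if \<exists>n. P n \<omega> then enat (LEAST n. P n \<omega>) else \<infinity>)" (is "stopping_time F ?\<tau>")
proof
  fix t
  show "Measurable.pred (F t) (\<lambda>\<omega>. ?\<tau> \<omega> \<le> t)"
  proof (cases t)
    case (enat N)
    have [measurable]: "Measurable.pred (F t) (P n)" if "n \<in> {..N}" for n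
      using assms that enat by simp
    have "?\<tau> \<omega> \<le> t \<longleftrightarrow> (\<exists>n\<in>{..N}. P n \<omega>)" for \<omega>
      unfolding enat by (auto intro: LeastI Least_le order_trans)
    then show ?thesis by simp
  qed simp
qed

section \<open>The random dyadic intervals\<close>

context simple_symmetric_random_walk
begin

abbreviation "code n \<omega> \<equiv> path_code (\<lambda>k. \<xi> k \<omega>) n"
abbreviation "lower n \<omega> \<equiv> code_lower (\<lambda>k. \<xi> k \<omega>) n"
abbreviation "upper n \<omega> \<equiv> code_upper (\<lambda>k. \<xi> k \<omega>) n"

lemma measurable_code [measurable]: "code n \<in> M \<rightarrow>\<^sub>M count_space UNIV"
  by (intro measurable_path_code measurable_increment) auto

text \<open>Almost surely a digit 0 means a step of -1, so the code fixes the first \<open>n\<close>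
  increments. The bound is an inequality because \<open>v\<close> might not occur as a code.\<close>

lemma prob_code_eq_le: "prob {\<omega> \<in> space M. code n \<omega> = v} \<le> (1 / 2) ^ n"
proof (cases "\<exists>\<omega>\<^sub>0. code n \<omega>\<^sub>0 = v")
  case True
  then obtain \<omega>\<^sub>0 where \<omega>\<^sub>0: "code n \<omega>\<^sub>0 = v" by blast
  \<comment> \<open>An arbitrary point \<open>\<omega>\<^sub>0\<close> may have increments other
    than 1 and -1, so its digits, rather than its increments, provide the signs.\<close>
  define e :: "nat \<Rightarrow> int" where "e k = (if \<xi> k \<omega>\<^sub>0 = 1 then 1 else -1)" for k
  have "prob {\<omega> \<in> space M. code n \<omega> = v} \<le> prob {\<omega> \<in> space M. \<forall>k\<in>{1..n}. \<xi> k \<omega> = e k}"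
  proof (rule finite_measure_mono_AE)
    show "AE \<omega> in M. \<omega> \<in> {\<omega> \<in> space M. code n \<omega> = v} \<longrightarrow>
        \<omega> \<in> {\<omega> \<in> space M. \<forall>k\<in>{1..n}. \<xi> k \<omega> = e k}"
      using AE_increments
    proof eventually_elim
      case (elim \<omega>)
      show ?case
      proof safe
        fix k assume k: "k \<in> {1..n}" and "v = code n \<omega>"
        then have "\<xi> k \<omega> = 1 \<longleftrightarrow> \<xi> k \<omega>\<^sub>0 = 1"
          using path_code_eqD[of "\<lambda>k. \<xi> k \<omega>" n "\<lambda>k. \<xi> k \<omega>\<^sub>0" k] \<omega>\<^sub>0 by simp
        then show "\<xi> k \<omega> = e k"
          using elim k by (auto simp: e_def)
      qed
    qed
    have [measurable]: "\<xi> k \<in> M \<rightarrow>\<^sub>M count_space UNIV" if "k \<in> {1..n}" for k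
      using that by (intro measurable_increment) auto
    show "{\<omega> \<in> space M. \<forall>k\<in>{1..n}. \<xi> k \<omega> = e k} \<in> events"
      by measurable
  qed
  also have "\<dots> = (1 / 2) ^ n"
    by (subst prob_increments_eq) (auto simp: e_def)
  finally show ?thesis .
next
  case False
  then have "{\<omega> \<in> space M. code n \<omega> = v} = {}" by blast
  then show ?thesis by (metis measure_empty zero_le_divide_1_iff zero_le_numeral zero_le_power)
qed

lemma prob_code_in_le:
  assumes "finite A"
  shows "prob {\<omega> \<in> space M. code n \<omega> \<in> A} \<le> card A / 2 ^ n"
proof -
  have "prob {\<omega> \<in> space M. code n \<omega> \<in> A} = prob (\<Union>v\<in>A. {\<omega> \<in> space M. code n \<omega> = v})"
    by (intro arg_cong[where f = prob]) auto
  also have "\<dots> \<le> (\<Sum>v\<in>A. prob {\<omega> \<in> space M. code n \<omega> = v})"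
    by (intro finite_measure_subadditive_finite assms) auto
  also have "\<dots> \<le> (\<Sum>v\<in>A. (1 / 2) ^ n)"
    by (intro sum_mono prob_code_eq_le)
  finally show ?thesis
    by (simp add: power_divide)
qed

text \<open>Nesting makes the events increase with \<open>n\<close>. At level \<open>n\<close> at
  most \<open>(b - a) * 2 ^ n\<close> codes qualify, each with probability at most
  \<open>(1 / 2) ^ n\<close>, so the bound survives in the limit.\<close>

lemma prob_code_interval_subset_le:
  assumes "0 \<le> a" "a \<le> b"
  shows "prob {\<omega> \<in> space M. \<exists>n. a \<le> lower n \<omega> \<and> upper n \<omega> \<le> b} \<le> b - a"
proof -
  define B where "B n = {\<omega> \<in> space M. a \<le> lower n \<omega> \<and> upper n \<omega> \<le> b}" for n
  have B: "B n = {\<omega> \<in> space M. code n \<omega> \<in> {v. a * 2 ^ n \<le> real v \<and> real v + 1 \<le> b * 2 ^ n}}" for n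
    by (auto simp: B_def code_lower_def code_upper_def field_simps)
  have "B n \<in> events" for n
    unfolding B by measurable
  moreover have "incseq B"
    unfolding B_def incseq_def
    using code_lower_mono code_upper_antimono by (blast intro: order_trans)
  ultimately have "(\<lambda>n. prob (B n)) \<longlonglongrightarrow> prob (\<Union>n. B n)"
    by (intro finite_Lim_measure_incseq) auto
  moreover have "prob (B n) \<le> b - a" for n
  proof -
    let ?A = "{v::nat. a * 2 ^ n \<le> real v \<and> real v + 1 \<le> b * 2 ^ n}"
    have "finite ?A" and card: "card ?A \<le> b * 2 ^ n - a * 2 ^ n"
      using assms card_unit_cells_between[of "a * 2 ^ n" "b * 2 ^ n"] by auto
    then have "prob (B n) \<le> card ?A / 2 ^ n"
      unfolding B using prob_code_in_le[of ?A n] by simp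
    also have "\<dots> \<le> b - a"
      using card by (simp add: field_simps)
    finally show ?thesis .
  qed
  ultimately have "prob (\<Union>n. B n) \<le> b - a"
    by (intro LIMSEQ_le_const2) auto
  moreover have "(\<Union>n. B n) = {\<omega> \<in> space M. \<exists>n. a \<le> lower n \<omega> \<and> upper n \<omega> \<le> b}"
    by (auto simp: B_def)
  ultimately show ?thesis by simp
qed

text \<open>The limiting variable has no atom: at level \<open>n\<close> at most two codes have
  \<open>a\<close> in their closed interval, and their total probability tends to 0.\<close>

lemma AE_code_avoids: "AE \<omega> in M. \<exists>n. a < lower n \<omega> \<or> upper n \<omega> < a"
proof -
  define B where "B n = {\<omega> \<in> space M. \<not> (a < lower n \<omega> \<or> upper n \<omega> < a)}" for n
  have B: "B n = {\<omega> \<in> space M. code n \<omega> \<in> {v. real v \<le> a * 2 ^ n \<and> a * 2 ^ n \<le> real v + 1}}" for n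
    by (auto simp: B_def code_lower_def code_upper_def field_simps not_less)
  have [measurable]: "B n \<in> events" for n
    unfolding B by measurable
  have le: "prob (\<Inter>n. B n) \<le> 2 * (1 / 2) ^ n" for n
  proof -
    let ?A = "{v::nat. real v \<le> a * 2 ^ n \<and> a * 2 ^ n \<le> real v + 1}"
    have "prob (\<Inter>n. B n) \<le> prob (B n)"
      by (intro finite_measure_mono) auto
    also have "\<dots> \<le> card ?A / 2 ^ n"
      unfolding B using prob_code_in_le[of ?A n] card_unit_cells_at(1) by (simp add: add.commute)
    also have "\<dots> \<le> 2 / 2 ^ n"
      using card_unit_cells_at(2)[of "a * 2 ^ n"] by (intro divide_right_mono) (simp_all add: add.commute)
    finally show ?thesis by (simp add: power_divide)
  qed
  have "(\<lambda>n. 2 * (1 / 2 :: real) ^ n) \<longlonglongrightarrow> 2 * 0"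
    by (intro tendsto_intros) auto
  then have "prob (\<Inter>n. B n) \<le> 0"
    using le by (intro LIMSEQ_le_const[of "\<lambda>n. 2 * (1 / 2 :: real) ^ n"]) auto
  then have "prob (\<Inter>n. B n) = 0"
    by (simp add: measure_le_0_iff)
  then have "AE \<omega> in M. \<omega> \<notin> (\<Inter>n. B n)"
    by (subst (asm) prob_eq_0) auto
  then show ?thesis
    using AE_space by eventually_elim (auto simp: B_def)
qed

text \<open>Almost surely the intervals eventually miss 1 and each \<open>c j\<close>. As
  \<open>lower\<close> is always below 1, missing 1 puts some \<open>upper\<close> below 1, hence
  below some \<open>c J\<close>. Only the points up to \<open>c J\<close> then matter, and a single
  level \<open>n\<close> misses all of them.\<close>

lemma AE_code_subset_cell:
  fixes c :: "nat \<Rightarrow> real"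
  assumes "c 0 = 0" "c \<longlonglongrightarrow> 1"
  shows "AE \<omega> in M. \<exists>j. \<exists>n. c j \<le> lower n \<omega> \<and> upper n \<omega> \<le> c (Suc j)"
proof -
  have "AE \<omega> in M. \<forall>j. \<exists>n. c j < lower n \<omega> \<or> upper n \<omega> < c j"
    by (simp add: AE_all_countable AE_code_avoids)
  then show ?thesis
    using AE_code_avoids[of 1]
  proof eventually_elim
    case (elim \<omega>)
    obtain n\<^sub>1 where "upper n\<^sub>1 \<omega> < 1"
      using elim(2) code_lower_less_1[of "\<lambda>k. \<xi> k \<omega>"] by (metis less_asym)
    then have "\<forall>\<^sub>F j in sequentially. upper n\<^sub>1 \<omega> < c j"
      using order_tendstoD(1)[OF assms(2)] by blast
    then obtain J where J: "upper n\<^sub>1 \<omega> < c J"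
      by (auto simp: eventually_sequentially)
    have "\<forall>\<^sub>F n in sequentially. c j < lower n \<omega> \<or> upper n \<omega> < c j" for j
    proof -
      obtain m where m: "c j < lower m \<omega> \<or> upper m \<omega> < c j"
        using elim(1) by blast
      have "c j < lower n \<omega> \<or> upper n \<omega> < c j" if "n \<ge> m" for n
        using m code_lower_mono[OF that, of "\<lambda>k. \<xi> k \<omega>"] code_upper_antimono[OF that, of "\<lambda>k. \<xi> k \<omega>"]
        by linarith
      then show ?thesis
        by (auto simp: eventually_sequentially)
    qed
    then have "\<forall>\<^sub>F n in sequentially. \<forall>j\<in>{..J}. c j < lower n \<omega> \<or> upper n \<omega> < c j"
      by (intro eventually_ball_finite) auto
    then have "\<forall>\<^sub>F n in sequentially. n \<ge> n\<^sub>1 \<and> (\<forall>j\<in>{..J}. c j < lower n \<omega> \<or> upper n \<omega> < c j)"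
      by (intro eventually_conj eventually_ge_at_top)
    then obtain n where n: "n\<^sub>1 \<le> n" "\<And>j. j \<le> J \<Longrightarrow> c j < lower n \<omega> \<or> upper n \<omega> < c j"
      by (auto simp: eventually_sequentially)
    \<comment> \<open>The first \<open>c j\<close> to the right of the interval. Its predecessor is
      not to the right and is missed too, so it lies to the left.\<close>
    define j where "j = (LEAST j. upper n \<omega> < c j)"
    have UJ: "upper n \<omega> < c J"
      using J code_upper_antimono[OF n(1)] by (rule le_less_trans[rotated])
    have Uj: "upper n \<omega> < c j"
      unfolding j_def by (rule LeastI[where P = "\<lambda>j. upper n \<omega> < c j", OF UJ])
    have "j \<le> J"
      unfolding j_def by (rule Least_le[where P = "\<lambda>j. upper n \<omega> < c j", OF UJ])
    \<comment> \<open>The predecessor exists because \<open>c 0 = 0\<close> is not above the right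
      endpoint.\<close>
    have "j \<noteq> 0"
      using Uj code_lower_less_upper[of "\<lambda>k. \<xi> k \<omega>" n] code_lower_nonneg[of "\<lambda>k. \<xi> k \<omega>" n] assms(1)
      by (cases j) auto
    then obtain i where i: "j = Suc i"
      by (cases j) auto
    then have "\<not> upper n \<omega> < c i"
      using not_less_Least[of i "\<lambda>j. upper n \<omega> < c j"] by (simp add: j_def)
    with n(2)[of i] \<open>j \<le> J\<close> i have "c i < lower n \<omega>" by simp
    with Uj i show ?case
      by (intro exI[of _ i] exI[of _ n]) auto
  qed
qed

section \<open>Construction of an embedding from the walk alone\<close>

lemma measurable_natural_filtration_increment:
  assumes "k \<ge> 1" "enat k \<le> t"
  shows "\<xi> k \<in> natural_filtration M (walk \<xi>) t \<rightarrow>\<^sub>M count_space UNIV"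
proof -
  let ?F = "natural_filtration M (walk \<xi>) t"
  have "enat (k - 1) \<le> t"
    using assms(2) by (meson diff_le_self enat_ord_simps(1) order_trans)
  then have w: "walk \<xi> k \<in> ?F \<rightarrow>\<^sub>M count_space UNIV" "walk \<xi> (k - 1) \<in> ?F \<rightarrow>\<^sub>M count_space UNIV"
    using assms(2) by (auto intro: measurable_natural_filtration)
  have "(\<lambda>\<omega>. walk \<xi> k \<omega> - i) \<in> ?F \<rightarrow>\<^sub>M count_space UNIV" for i
    by (rule measurable_compose[OF w(1)]) simp
  from measurable_compose_countable[OF this w(2)]
  have "(\<lambda>\<omega>. walk \<xi> k \<omega> - walk \<xi> (k - 1) \<omega>) \<in> ?F \<rightarrow>\<^sub>M count_space UNIV" .
  moreover have "walk \<xi> k \<omega> - walk \<xi> (k - 1) \<omega> = \<xi> k \<omega>" for \<omega>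
    using assms(1) by (cases k) (simp_all add: walk_def)
  ultimately show ?thesis by simp
qed

text \<open>
  The target is \<open>int_decode j\<close> as soon as some \<open>[lower n \<omega>, upper n \<omega>]\<close> lies in the cell
  \<open>[c j, c (Suc j)]\<close> of length \<open>\<mu> {int_decode j}\<close>. It suffices to bound the law of the stopped
  value from above, since both laws have total mass 1.
\<close>

lemma embedding_exists:
  assumes "prob_space \<mu>" and sets_\<mu>: "sets \<mu> = sets (count_space UNIV)"
  obtains \<tau> where "stopping_time (natural_filtration M (walk \<xi>)) \<tau>" "embeds M (walk \<xi>) \<tau> \<mu>"
proof -
  interpret \<mu>: prob_space \<mu> by fact
  let ?F = "natural_filtration M (walk \<xi>)"
  \<comment> \<open>The cumulative masses of \<open>\<mu>\<close> along the enumeration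
    \<open>int_decode\<close> of the integers; they cut the unit interval into cells.\<close>
  define c where "c j = measure \<mu> (int_decode ` {..<j})" for j
  have c_Suc: "c (Suc j) = c j + measure \<mu> {int_decode j}" for j
  proof -
    have "int_decode ` {..<Suc j} = int_decode ` {..<j} \<union> {int_decode j}"
      by (auto simp: lessThan_Suc)
    moreover have "int_decode j \<notin> int_decode ` {..<j}"
      by (auto simp: inj_eq[OF bij_is_inj[OF bij_int_decode]])
    ultimately show ?thesis
      unfolding c_def by (simp only:) (rule \<mu>.finite_measure_Union; simp add: sets_\<mu>)
  qed
  have c_lim: "c \<longlonglongrightarrow> 1"
  proof -
    have "(\<lambda>j. c j) \<longlonglongrightarrow> measure \<mu> (\<Union>j. int_decode ` {..<j})"
      unfolding c_def
      by (intro \<mu>.finite_Lim_measure_incseq) (auto simp: sets_\<mu> incseq_def)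
    moreover have "(\<Union>j. int_decode ` {..<j}) = space \<mu>"
    proof -
      have "(\<Union>j. int_decode ` {..<j}) = range int_decode"
        by (auto intro: lessI)
      then show ?thesis
        using sets_eq_imp_space_eq[OF sets_\<mu>] bij_is_surj[OF bij_int_decode] by simp
    qed
    ultimately show ?thesis
      by (simp add: \<mu>.prob_space)
  qed
  define cell where "cell j n \<omega> \<longleftrightarrow> c j \<le> lower n \<omega> \<and> upper n \<omega> \<le> c (Suc j)" for j n \<omega>
  have cell: "Measurable.pred N (cell j n)"
    if "\<And>k. k \<in> {1..n} \<Longrightarrow> \<xi> k \<in> N \<rightarrow>\<^sub>M count_space UNIV" for N j n
  proof -
    note [measurable] = measurable_code_bounds[of n \<xi> N, OF that]
    show ?thesis
      unfolding cell_def[abs_def] by measurable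
  qed
  \<comment> \<open>The interval may have entered the cell at an earlier time \<open>m\<close>,
    after which the walk has to reach the target. Both facts are known at time
    \<open>n\<close>.\<close>
  define ready where "ready n \<omega> \<longleftrightarrow> (\<exists>j. \<exists>m\<in>{..n}. cell j m \<omega> \<and> walk \<xi> n \<omega> = int_decode j)" for n \<omega>
  define \<tau> where "\<tau> \<omega> = (if \<exists>n. ready n \<omega> then enat (LEAST n. ready n \<omega>) else \<infinity>)" for \<omega>
  have stop: "stopping_time ?F \<tau>"
    unfolding \<tau>_def[abs_def]
  proof (rule stopping_time_first)
    fix n t
    assume "enat n \<le> t"
    then have "enat m \<le> t" if "m \<le> n" for m
      using that by (meson enat_ord_simps(1) order_trans)
    then have [measurable]: "Measurable.pred (?F t) (cell j m)" if "m \<in> {..n}" for j m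
      using that by (intro cell measurable_natural_filtration_increment) auto
    have [measurable]: "walk \<xi> n \<in> ?F t \<rightarrow>\<^sub>M count_space UNIV"
      by (rule measurable_natural_filtration) fact
    show "Measurable.pred (?F t) (ready n)"
      unfolding ready_def[abs_def] by measurable
  qed
  have "AE \<omega> in M. \<exists>j. \<exists>m. cell j m \<omega>"
    unfolding cell_def by (rule AE_code_subset_cell[OF _ c_lim]) (simp add: c_def)
  \<comment> \<open>Some cell is entered almost surely, and recurrence brings the walk to its target
    at or after that time.\<close>
  then have finite: "AE \<omega> in M. \<tau> \<omega> < \<infinity>"
    using AE_recurrent
  proof eventually_elim
    case (elim \<omega>)
    then obtain j m where "cell j m \<omega>" by blast
    moreover obtain n where "n \<ge> m" "walk \<xi> n \<omega> = int_decode j"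
      using elim by blast
    ultimately have "ready n \<omega>"
      unfolding ready_def by auto
    then show ?case
      by (auto simp: \<tau>_def)
  qed
  note V [measurable] = measurable_stopped_value[OF measurable_walk
      measurable_natural_stopping_time[OF measurable_walk stop]]
  have "stopped_law M (walk \<xi>) \<tau> = \<mu>"
  proof (rule prob_space_eqI_le)
    show "prob_space (stopped_law M (walk \<xi>) \<tau>)"
      unfolding stopped_law_def by (rule prob_space_distr) fact
    fix z
    obtain j where z: "z = int_decode j"
      using bij_is_surj[OF bij_int_decode] by blast
    have [measurable]: "Measurable.pred M (cell j m)" for m
      by (intro cell measurable_increment) auto
    have "measure (stopped_law M (walk \<xi>) \<tau>) {z} = prob (stopped_value (walk \<xi>) \<tau> -` {z} \<inter> space M)"
      unfolding stopped_law_def by (subst measure_distr) (use V in auto)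
    \<comment> \<open>At time \<open>\<tau>\<close> the walk is at the target of a cell already
      entered. By injectivity of \<open>int_decode\<close>, the value \<open>z\<close> can only come
      from cell \<open>j\<close>.\<close>
    also have "\<dots> \<le> prob {\<omega> \<in> space M. \<exists>m. cell j m \<omega>}"
    proof (rule finite_measure_mono_AE)
      show "AE \<omega> in M. \<omega> \<in> stopped_value (walk \<xi>) \<tau> -` {z} \<inter> space M \<longrightarrow>
          \<omega> \<in> {\<omega> \<in> space M. \<exists>m. cell j m \<omega>}"
        using finite
      proof eventually_elim
        case (elim \<omega>)
        then obtain n where "ready n \<omega>"
          by (auto simp: \<tau>_def split: if_splits)
        then have "\<tau> \<omega> = enat (LEAST n. ready n \<omega>)" "ready (LEAST n. ready n \<omega>) \<omega>"
          by (auto simp: \<tau>_def intro: LeastI)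
        then have "\<exists>i m. cell i m \<omega> \<and> stopped_value (walk \<xi>) \<tau> \<omega> = int_decode i"
          unfolding stopped_value_def ready_def[of "LEAST n. ready n \<omega>"] by auto
        then show ?case
          by (auto simp: z inj_eq[OF bij_is_inj[OF bij_int_decode]])
      qed
    qed measurable
    also have "\<dots> \<le> c (Suc j) - c j"
      unfolding cell_def
      by (rule prob_code_interval_subset_le) (simp_all add: c_Suc, simp add: c_def)
    also have "\<dots> = measure \<mu> {z}"
      by (simp add: c_Suc z)
    finally show "measure (stopped_law M (walk \<xi>) \<tau>) {z} \<le> measure \<mu> {z}" .
  qed (simp_all add: sets_\<mu> stopped_law_def \<mu>.prob_space_axioms)
  with finite stop show ?thesis
    by (intro that[of \<tau>]) (auto simp: embeds_def)
qed

end

theorem theorem2: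
  fixes M :: "'a measure" and \<xi> :: "nat \<Rightarrow> 'a \<Rightarrow> int" and \<mu> :: "int measure"
  assumes "simple_symmetric_random_walk M \<xi>"
    and "prob_space \<mu>" and "sets \<mu> = sets (count_space UNIV)"
  shows "\<exists>\<tau>. minimal_stopping_time M (walk \<xi>) \<tau> \<and> embeds M (walk \<xi>) \<tau> \<mu>"
proof -
  interpret simple_symmetric_random_walk M \<xi> by fact
  obtain \<tau>\<^sub>0 where "stopping_time (natural_filtration M (walk \<xi>)) \<tau>\<^sub>0" "embeds M (walk \<xi>) \<tau>\<^sub>0 \<mu>"
    using embedding_exists[OF assms(2,3)] .
  from minimal_stopping_time_below[OF measurable_walk this] show ?thesis
    by blast
qed

end
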